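(* Let $n,i,j\ge0$, $k\ge3$ be integers and $m\in\{1,2\}$. The number of partitions counted by $A^k_m(n)$ that have exactly $i$ parts $\equiv 3-m\pmod k$ and exactly $j$ parts $\equiv m\pmod k$ equals the number of partitions counted by $C^k_m(n)$ that have exactly $i$ parts $\equiv 3-m\pmod{2k}$ and exactly $j$ parts $\equiv k+m\pmod{2k}$. In particular $A^k_m(n)=C^k_m(n)$.
   Context: A partition is $k$-strict if for every $m'\in\mathbb{N}$ and all $1\le r_1\le r_2\le k-1$, the numbers $m'k+r_1$ and $m'k+r_2$ do not appear together as parts. For a partition $\pi=(\pi_1\ge\pi_2\ge\cdots)$, the odd-indexed parts are $\pi_1,\pi_3,\dots$ and the even-indexed parts are $\pi_2,\pi_4,\dots$. $A^k_m(n)$ is the number of $k$-strict partitions of $n$ such that (i) no part is repeated, (ii) every odd-indexed part is $\equiv k$ or $\equiv 3-m\pmod k$, (iii) every even-indexed part is $\equiv k$ or $\equiv m\pmod k$. $C^k_m(n)$ is the number of partitions of $n$ into distinct parts each congruent to $3-m$, $k$, $k+m$ or $2k$ modulo $2k$. *)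

theory Defs
  imports "HOL-Number_Theory.Cong"
begin

text \<open>
  A partition is represented by the weakly decreasing list of its (positive) parts, so that the
  part usually written \<open>\<pi>\<^sub>t\<close> (with \<open>t \<ge> 1\<close>) is \<open>\<pi> ! (t - 1)\<close>.
\<close>

definition partition_of :: "nat \<Rightarrow> nat list \<Rightarrow> bool" where
  "partition_of n \<pi> \<longleftrightarrow> sorted_wrt (\<ge>) \<pi> \<and> (\<forall>x\<in>set \<pi>. 0 < x) \<and> sum_list \<pi> = n"

text \<open>
  Two numbers appear together as parts if they occur at two different positions; in particular
  \<open>x\<close> appears together with itself iff it is a repeated part.
\<close>

definition appear_together :: "nat \<Rightarrow> nat \<Rightarrow> nat list \<Rightarrow> bool" where
  "appear_together x y \<pi> \<longleftrightarrow>
     (\<exists>s<length \<pi>. \<exists>t<length \<pi>. s \<noteq> t \<and> \<pi> ! s = x \<and> \<pi> ! t = y)"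

definition k_strict :: "nat \<Rightarrow> nat list \<Rightarrow> bool" where
  "k_strict k \<pi> \<longleftrightarrow>
     (\<forall>m' r1 r2. 1 \<le> r1 \<and> r1 \<le> r2 \<and> r2 \<le> k - 1 \<longrightarrow>
        \<not> appear_together (m' * k + r1) (m' * k + r2) \<pi>)"

text \<open>The parameter \<open>m\<close> below is meant to be 1 or 2, so \<open>3 - m\<close> is not truncated.\<close>

definition A_partitions :: "nat \<Rightarrow> nat \<Rightarrow> nat \<Rightarrow> nat list set" where
  "A_partitions k m n = {\<pi>. partition_of n \<pi> \<and> k_strict k \<pi> \<and> distinct \<pi> \<and>
     (\<forall>t\<in>{1..length \<pi>}. odd t \<longrightarrow>
        [\<pi> ! (t - 1) = k] (mod k) \<or> [\<pi> ! (t - 1) = 3 - m] (mod k)) \<and>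
     (\<forall>t\<in>{1..length \<pi>}. even t \<longrightarrow>
        [\<pi> ! (t - 1) = k] (mod k) \<or> [\<pi> ! (t - 1) = m] (mod k))}"

definition C_partitions :: "nat \<Rightarrow> nat \<Rightarrow> nat \<Rightarrow> nat list set" where
  "C_partitions k m n = {\<pi>. partition_of n \<pi> \<and> distinct \<pi> \<and>
     (\<forall>x\<in>set \<pi>. [x = 3 - m] (mod 2 * k) \<or> [x = k] (mod 2 * k) \<or>
                 [x = k + m] (mod 2 * k) \<or> [x = 2 * k] (mod 2 * k))}"

definition A :: "nat \<Rightarrow> nat \<Rightarrow> nat \<Rightarrow> nat" where
  "A k m n = card (A_partitions k m n)"

definition C :: "nat \<Rightarrow> nat \<Rightarrow> nat \<Rightarrow> nat" where
  "C k m n = card (C_partitions k m n)"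

definition parts_cong :: "nat \<Rightarrow> nat \<Rightarrow> nat list \<Rightarrow> nat" where
  "parts_cong r q \<pi> = length (filter (\<lambda>x. [x = r] (mod q)) \<pi>)"

text \<open>The sets counted are finite, so \<^const>\<open>card\<close> has its intended meaning.\<close>

lemma finite_partitions: "finite {\<pi>. partition_of n \<pi>}"
proof (rule finite_subset)
  have len: "length \<pi> \<le> sum_list \<pi>" if "\<forall>x\<in>set \<pi>. 0 < x" for \<pi> :: "nat list"
    using that by (induction \<pi>) auto
  show "{\<pi>. partition_of n \<pi>} \<subseteq> {\<pi>. set \<pi> \<subseteq> {..n} \<and> length \<pi> \<le> n}"
    unfolding partition_of_def using len by (auto intro: member_le_sum_list)
  show "finite {\<pi>. set \<pi> \<subseteq> {..n} \<and> length \<pi> \<le> n}"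
    by (rule finite_lists_length_le) simp
qed

lemma finite_A_partitions: "finite (A_partitions k m n)"
  and finite_C_partitions: "finite (C_partitions k m n)"
  by (auto simp: A_partitions_def C_partitions_def intro: finite_subset[OF _ finite_partitions])

end

theory Submission
  imports Defs "HOL-Computational_Algebra.Polynomial"
begin

text \<open>
  Give a part \<open>k u\<close>, \<open>k u + a\<close>, \<open>k u + b\<close> (where \<open>a = 3 - m\<close>, \<open>b = m\<close>) the weight
  \<open>z^u\<close>, \<open>x z^u\<close>, \<open>y z^u\<close>, respectively. Prepending a largest part to an \<open>A\<close>-partition
  exchanges the roles of \<open>a\<close> and \<open>b\<close>. This gives a recursion for the generating function
  of the \<open>A\<close>-partitions with parts less than \<open>k (n + 1)\<close>, which is solved by
  \<open>\<Sum>i\<le>n. [n choose i] (-x; q)_(n-i+1) (-y; q)_i z^i\<close> with \<open>q = z\<^sup>2\<close>; it is a finite form of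
  Boulet's formula for four-parameter weights of strict partitions. Modulo \<open>z^n\<close> the sum equals
  \<open>(-x; q)_(n+1) D y\<close>, where \<open>D y = (1 + y z) D (y q)\<close> and \<open>D 0 = (1 + z) \<cdots> (1 + z^n)\<close>,
  because \<open>D 0\<close> counts partitions into distinct multiples of \<open>k\<close>. Hence it equals
  \<open>(-x; q)_(n+1) (-y z; q)_n (1 + z) \<cdots> (1 + z^n)\<close>, the generating function of the
  \<open>C\<close>-partitions. All identities are congruences in a commutative ring, so no limits are needed.
\<close>

section \<open>Gaussian binomial coefficients\<close>

text \<open>Given by a Pascal rule because quotients of q-factorials need not make sense in a
  commutative ring. For n < k the truncated exponent n - k is harmless: the coefficient beside it is
  0.\<close>

fun qbinomial :: "'a::comm_ring_1 \<Rightarrow> nat \<Rightarrow> nat \<Rightarrow> 'a" where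
  "qbinomial q n 0 = 1"
| "qbinomial q 0 (Suc k) = 0"
| "qbinomial q (Suc n) (Suc k) = qbinomial q n (Suc k) + q ^ (n - k) * qbinomial q n k"

lemma qbinomial_eq_0: "n < k \<Longrightarrow> qbinomial q n k = 0"
  by (induction q n k rule: qbinomial.induct) auto

lemma qbinomial_self [simp]: "qbinomial q n n = 1"
  by (induction n) (auto simp: qbinomial_eq_0)

text \<open>The second Pascal rule: expand both terms of the first one by induction and regroup. The
  case k = 0 stands apart because its lower term cannot be expanded.\<close>

lemma qbinomial_Suc_Suc':
  "qbinomial q (Suc n) (Suc k) = q ^ Suc k * qbinomial q n (Suc k) + qbinomial q n k"
proof (induction n arbitrary: k)
  case 0
  then show ?case by (cases k) auto
next
  case (Suc n)
  show ?case
  proof (cases k)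
    case 0
    have "qbinomial q (Suc (Suc n)) (Suc k) = qbinomial q (Suc n) (Suc 0) + q ^ Suc n"
      using 0 by simp
    also have "\<dots> = (q * qbinomial q n (Suc 0) + 1) + q ^ Suc n"
      using Suc.IH[of 0] by simp
    also have "\<dots> = q * (qbinomial q n (Suc 0) + q ^ n) + 1"
      by (simp add: algebra_simps)
    finally show ?thesis
      using 0 by simp
  next
    case (Suc l)
    consider "n < l" | "n = l" | "l < n" by linarith
    then show ?thesis
    proof cases
      case 3
      \<comment> \<open>Both products are q^(n+1).\<close>
      then have e: "q ^ (Suc n - Suc l) * q ^ Suc l = q ^ Suc k * q ^ (n - Suc l)"
        using Suc by (simp flip: power_add power_Suc)
      have "qbinomial q (Suc (Suc n)) (Suc k)
        = qbinomial q (Suc n) (Suc k) + q ^ (Suc n - Suc l) * qbinomial q (Suc n) (Suc l)"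
        using Suc by simp
      also have "\<dots> = (q ^ Suc k * qbinomial q n (Suc k) + qbinomial q n k)
          + q ^ (Suc n - Suc l) * (q ^ Suc l * qbinomial q n (Suc l) + qbinomial q n l)"
        by (simp only: Suc.IH)
      also have "\<dots> = q ^ Suc k * (qbinomial q n (Suc k) + q ^ (n - Suc l) * qbinomial q n (Suc l))
          + (qbinomial q n k + q ^ (Suc n - Suc l) * qbinomial q n l)"
        using e by (simp add: ring_distribs mult.assoc [symmetric] del: power_Suc)
      also have "\<dots> = q ^ Suc k * qbinomial q (Suc n) (Suc k) + qbinomial q (Suc n) k"
        using Suc by simp
      finally show ?thesis .
    qed (use Suc in \<open>auto simp: qbinomial_eq_0\<close>)
  qed
qed

text \<open>Replacing k by n - k exchanges the two Pascal rules.\<close>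

lemma qbinomial_symmetric:
  "k \<le> n \<Longrightarrow> qbinomial q n (n - k) = qbinomial q n k"
proof (induction n arbitrary: k)
  case (Suc n)
  show ?case
  proof (cases "k = 0 \<or> k = Suc n")
    case False
    then obtain l where k: "k = Suc l" and l: "l < n"
      using Suc.prems by (cases k) auto
    then obtain r where r: "n - l = Suc r" "r = n - Suc l"
      by (metis Suc_diff_Suc)
    have "qbinomial q (Suc n) (Suc n - k) = qbinomial q (Suc n) (Suc r)"
      using k r by simp
    also have "\<dots> = q ^ (n - l) * qbinomial q n (n - l) + qbinomial q n (n - Suc l)"
      unfolding qbinomial_Suc_Suc' using r by simp
    also have "\<dots> = q ^ (n - l) * qbinomial q n l + qbinomial q n (Suc l)"
      using l by (simp add: Suc.IH)
    also have "\<dots> = qbinomial q (Suc n) k"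
      using k by simp
    finally show ?thesis .
  qed auto
qed auto

text \<open>The q-analogue of (k+1) C(n+1,k+1) = (n+1) C(n,k). Equating the two Pascal rules relates
  neighbouring coefficients of row n.\<close>

lemma qbinomial_absorption:
  "(1 - q ^ Suc k) * qbinomial q (Suc n) (Suc k) = (1 - q ^ Suc n) * qbinomial q n k"
proof (cases "k \<le> n")
  case True
  then have e: "q ^ (n - k) * q ^ Suc k = q ^ Suc n"
    by (simp flip: power_add power_Suc)
  have "(1 - q ^ Suc k) * qbinomial q n (Suc k) = (1 - q ^ (n - k)) * qbinomial q n k"
    using qbinomial_Suc_Suc'[of q n k] by (simp add: algebra_simps)
  then have "(1 - q ^ Suc k) * qbinomial q (Suc n) (Suc k)
    = (1 - q ^ (n - k)) * qbinomial q n k + (q ^ (n - k) - q ^ (n - k) * q ^ Suc k) * qbinomial q n k"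
    by (simp add: ring_distribs mult_ac)
  then show ?thesis
    unfolding e by (simp add: algebra_simps)
qed (simp add: qbinomial_eq_0)

section \<open>Finite q-Pochhammer products\<close>

text \<open>In the usual notation this is \<open>(-x; q)_n\<close>, with a minus sign.\<close>

definition qpoch :: "'a::comm_ring_1 \<Rightarrow> 'a \<Rightarrow> nat \<Rightarrow> 'a" where
  "qpoch x q n = (\<Prod>t<n. 1 + x * q ^ t)"

lemma qpoch_0 [simp]: "qpoch x q 0 = 1" "qpoch 0 q n = 1"
  by (simp_all add: qpoch_def)

lemma qpoch_Suc: "qpoch x q (Suc n) = qpoch x q n * (1 + x * q ^ n)"
  by (simp add: qpoch_def)

lemma qpoch_Suc': "qpoch x q (Suc n) = (1 + x) * qpoch (x * q) q n"
  unfolding qpoch_def prod.lessThan_Suc_shift by (simp add: mult_ac)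

text \<open>The extra factors 1 + x q^t have t >= n, so they are 1 modulo q^n. This takes the place
  of convergence to an infinite product.\<close>

lemma dvd_qpoch_diff: "n \<le> n' \<Longrightarrow> q ^ n dvd qpoch x q n - qpoch x q n'"
proof (induction n' rule: dec_induct)
  case (step n')
  have "qpoch x q n - qpoch x q (Suc n')
    = (qpoch x q n - qpoch x q n') - q ^ n' * (x * qpoch x q n')"
    by (simp add: qpoch_Suc algebra_simps)
  with step show ?case
    by (metis dvd_diff dvd_mult2 le_imp_power_dvd)
qed simp

lemma dvd_qpoch_minus_1: "x dvd qpoch x q n - 1"
proof (induction n)
  case (Suc n)
  have "qpoch x q (Suc n) - 1 = (qpoch x q n - 1) + x * (q ^ n * qpoch x q n)"
    by (simp add: qpoch_Suc algebra_simps)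
  with Suc show ?case
    by (metis dvd_add dvd_triv_left)
qed simp

section \<open>Recursions for the Boulet sum\<close>

text \<open>The cases \<open>e = 0\<close> and \<open>e = 1\<close> belong to the bounds \<open>k n\<close> and \<open>k n + k - 1\<close> on the parts.\<close>

definition boulet_sum :: "nat \<Rightarrow> 'a::comm_ring_1 \<Rightarrow> nat \<Rightarrow> 'a \<Rightarrow> 'a \<Rightarrow> 'a" where
  "boulet_sum e z n x y =
     (\<Sum>i\<le>n. qbinomial (z\<^sup>2) n i * qpoch x (z\<^sup>2) (n - i + e) * qpoch y (z\<^sup>2) i * z ^ i)"

text \<open>In this form the swapped sum can be matched term by term in the two recursions
  below.\<close>

lemma boulet_sum_reflect:
  "boulet_sum e z n y x =
     (\<Sum>i\<le>n. qbinomial (z\<^sup>2) n i * qpoch y (z\<^sup>2) (i + e) * qpoch x (z\<^sup>2) (n - i) * z ^ (n - i))"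
  unfolding boulet_sum_def atMost_atLeast0
  by (subst sum.atLeastAtMost_rev) (auto intro!: sum.cong simp: qbinomial_symmetric)

text \<open>The Pascal rule splits every coefficient; one half gives the first summand, the other,
  reflected, the second. On partitions this is the choice whether k(n+1) is the largest
  part.\<close>

lemma boulet_sum_even:
  "boulet_sum 0 z (Suc n) x y = boulet_sum 1 z n x y + z ^ Suc n * boulet_sum 1 z n y x"
proof -
  let ?q = "z\<^sup>2"
  let ?t = "\<lambda>i. qpoch x ?q (Suc n - i) * qpoch y ?q i * z ^ i"
  \<comment> \<open>As q = z^2, the exponents agree: 2(n-i) + (i+1) = (n+1) + (n-i).\<close>
  have pow: "?q ^ (n - i) * z ^ Suc i = z ^ Suc n * z ^ (n - i)" if "i \<le> n" for i
  proof -
    have "2 * (n - i) + Suc i = Suc n + (n - i)"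
      using that by simp
    then show ?thesis
      by (metis power_add power_mult)
  qed
  have "boulet_sum 0 z (Suc n) x y = qbinomial ?q (Suc n) 0 * ?t 0
      + (\<Sum>i\<le>n. qbinomial ?q n (Suc i) * ?t (Suc i)) + (\<Sum>i\<le>n. ?q ^ (n - i) * qbinomial ?q n i * ?t (Suc i))"
    unfolding boulet_sum_def sum.atMost_Suc_shift
    by (simp add: ring_distribs sum.distrib add_ac mult_ac)
  \<comment> \<open>The term i = 0 rejoins the shifted sum, whose top term i = n+1 is 0.\<close>
  also have "qbinomial ?q (Suc n) 0 * ?t 0 + (\<Sum>i\<le>n. qbinomial ?q n (Suc i) * ?t (Suc i))
      = (\<Sum>i\<le>Suc n. qbinomial ?q n i * ?t i)"
    by (simp add: sum.atMost_Suc_shift del: sum.atMost_Suc)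
  also have "\<dots> = boulet_sum 1 z n x y"
    by (simp add: boulet_sum_def qbinomial_eq_0 Suc_diff_le mult_ac)
  also have "(\<Sum>i\<le>n. ?q ^ (n - i) * qbinomial ?q n i * ?t (Suc i)) = z ^ Suc n * boulet_sum 1 z n y x"
    unfolding boulet_sum_reflect sum_distrib_left
  proof (intro sum.cong refl)
    fix i assume "i \<in> {..n}"
    then have "i \<le> n" by simp
    have "?q ^ (n - i) * qbinomial ?q n i * ?t (Suc i)
      = qbinomial ?q n i * qpoch y ?q (Suc i) * qpoch x ?q (n - i) * (?q ^ (n - i) * z ^ Suc i)"
      by (simp only: diff_Suc_Suc mult_ac)
    then show "?q ^ (n - i) * qbinomial ?q n i * ?t (Suc i)
      = z ^ Suc n * (qbinomial ?q n i * qpoch y ?q (i + 1) * qpoch x ?q (n - i) * z ^ (n - i))"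
      unfolding pow[OF \<open>i \<le> n\<close>] by (simp add: mult_ac)
  qed
  finally show ?thesis .
qed

text \<open>The last factor of the longer product in x is 1 + x q^(n-i); its two summands give the
  two sums, the second after reflection. On partitions: whether kn + a is the largest part.\<close>

lemma boulet_sum_odd:
  "boulet_sum 1 z n x y = boulet_sum 0 z n x y + x * z ^ n * boulet_sum 0 z n y x"
proof -
  let ?q = "z\<^sup>2"
  have pow: "?q ^ (n - i) * z ^ i = z ^ n * z ^ (n - i)" if "i \<le> n" for i
  proof -
    have "2 * (n - i) + i = n + (n - i)"
      using that by simp
    then show ?thesis
      by (metis power_add power_mult)
  qed
  show ?thesis
    unfolding boulet_sum_reflect[of 0 z n y x]
    unfolding boulet_sum_def sum_distrib_left sum.distrib [symmetric]
  proof (intro sum.cong refl)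
    fix i assume "i \<in> {..n}"
    then have "i \<le> n" by simp
    let ?c = "qbinomial ?q n i * qpoch y ?q i * qpoch x ?q (n - i)"
    have "qbinomial ?q n i * qpoch x ?q (n - i + 1) * qpoch y ?q i * z ^ i
      = ?c * z ^ i + x * ?c * (?q ^ (n - i) * z ^ i)"
      by (simp add: qpoch_Suc algebra_simps)
    also have "\<dots> = ?c * z ^ i + x * ?c * (z ^ n * z ^ (n - i))"
      unfolding pow[OF \<open>i \<le> n\<close>] ..
    finally show "qbinomial ?q n i * qpoch x ?q (n - i + 1) * qpoch y ?q i * z ^ i
      = qbinomial ?q n i * qpoch x ?q (n - i + 0) * qpoch y ?q i * z ^ i +
        x * z ^ n * (qbinomial ?q n i * qpoch y ?q (i + 0) * qpoch x ?q (n - i) * z ^ (n - i))"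
      by (simp add: mult_ac)
  qed
qed

text \<open>At x = y = 0 all Pochhammer products are 1, so the cases e = 0 and e = 1 coincide and
  \<open>boulet_sum_even\<close> contributes one factor per step.\<close>

lemma boulet_sum_0_0: "boulet_sum e z n 0 0 = (\<Prod>t<n. 1 + z ^ Suc t)"
proof (induction n)
  case 0
  then show ?case by (simp add: boulet_sum_def)
next
  case (Suc n)
  have "boulet_sum e z (Suc n) 0 0 = boulet_sum 0 z (Suc n) 0 0"
    by (simp add: boulet_sum_def)
  also have "\<dots> = (1 + z ^ Suc n) * boulet_sum 1 z n 0 0"
    unfolding boulet_sum_even by (simp add: ring_distribs)
  also have "boulet_sum 1 z n 0 0 = boulet_sum e z n 0 0"
    by (simp add: boulet_sum_def)
  finally show ?case
    by (simp add: Suc mult_ac)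
qed

section \<open>The product formula modulo a power of z\<close>

text \<open>In term i, lengthening the product in x costs a multiple of q^(n-i+1) z^i, and 2(n-i+1)
  + i >= n. The product then leaves the sum.\<close>

lemma boulet_sum_eq_mod:
  "z ^ n dvd boulet_sum 1 z n x y - qpoch x (z\<^sup>2) (Suc n) * boulet_sum 1 z n 0 y"
proof -
  have "boulet_sum 1 z n x y - qpoch x (z\<^sup>2) (Suc n) * boulet_sum 1 z n 0 y
    = (\<Sum>i\<le>n. qbinomial (z\<^sup>2) n i * qpoch y (z\<^sup>2) i *
        ((qpoch x (z\<^sup>2) (n - i + 1) - qpoch x (z\<^sup>2) (Suc n)) * z ^ i))"
    unfolding boulet_sum_def sum_distrib_left sum_subtractf [symmetric]
    by (intro sum.cong) (simp_all add: algebra_simps)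
  also have "z ^ n dvd \<dots>"
  proof (rule dvd_sum, rule dvd_mult)
    fix i assume "i \<in> {..n}"
    then have le: "n \<le> 2 * (n - i + 1) + i" by simp
    have "(z\<^sup>2) ^ (n - i + 1) dvd qpoch x (z\<^sup>2) (n - i + 1) - qpoch x (z\<^sup>2) (Suc n)"
      by (rule dvd_qpoch_diff) simp
    then have "(z\<^sup>2) ^ (n - i + 1) * z ^ i dvd (qpoch x (z\<^sup>2) (n - i + 1) - qpoch x (z\<^sup>2) (Suc n)) * z ^ i"
      by (intro mult_dvd_mono dvd_refl)
    moreover have "z ^ n dvd (z\<^sup>2) ^ (n - i + 1) * z ^ i"
      using le by (simp only: power_mult [symmetric] power_add [symmetric] le_imp_power_dvd)
    ultimately show "z ^ n dvd (qpoch x (z\<^sup>2) (n - i + 1) - qpoch x (z\<^sup>2) (Suc n)) * z ^ i"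
      using dvd_trans by blast
  qed
  finally show ?thesis .
qed

text \<open>For x = 0 the odd recursion is trivial and the even one adds a multiple of
  z^(n+1).\<close>

lemma boulet_sum_Suc_eq_mod:
  "z ^ Suc n dvd boulet_sum 1 z (Suc n) 0 y - boulet_sum 1 z n 0 y"
  using boulet_sum_even[of z n 0 y] boulet_sum_odd[of z "Suc n" 0 y] by simp

text \<open>The products (-y; q)_(i+1) and (-yq; q)_(i+1) differ by y (1 - q^(i+1)) (-yq; q)_i, and
  absorption turns 1 - q^(i+1) into the constant 1 - q^(n+1).\<close>

lemma boulet_sum_shift:
  "boulet_sum 1 z (Suc n) 0 y = boulet_sum 1 z (Suc n) 0 (y * z\<^sup>2)
     + y * z * (1 - (z\<^sup>2) ^ Suc n) * boulet_sum 1 z n 0 (y * z\<^sup>2)"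
proof -
  let ?q = "z\<^sup>2"
  let ?p = "\<lambda>i. qpoch (y * ?q) ?q i"
  have diff: "qpoch y ?q (Suc i) - ?p (Suc i) = y * (1 - ?q ^ Suc i) * ?p i" for i
    using qpoch_Suc'[of y ?q i] qpoch_Suc[of "y * ?q" ?q i] by (simp add: algebra_simps)
  have "boulet_sum 1 z (Suc n) 0 y - boulet_sum 1 z (Suc n) 0 (y * ?q)
    = (\<Sum>i\<le>Suc n. qbinomial ?q (Suc n) i * (qpoch y ?q i - ?p i) * z ^ i)"
    unfolding boulet_sum_def sum_subtractf [symmetric]
    by (intro sum.cong) (simp_all add: algebra_simps)
  also have "\<dots> = (\<Sum>i\<le>n. qbinomial ?q (Suc n) (Suc i) * (y * (1 - ?q ^ Suc i) * ?p i) * z ^ Suc i)"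
    unfolding sum.atMost_Suc_shift diff by simp
  also have "\<dots> = (\<Sum>i\<le>n. y * z * ((1 - ?q ^ Suc i) * qbinomial ?q (Suc n) (Suc i)) * ?p i * z ^ i)"
    by (intro sum.cong refl) (simp only: power_Suc mult_ac)
  also have "\<dots> = y * z * (1 - ?q ^ Suc n) * boulet_sum 1 z n 0 (y * ?q)"
    unfolding qbinomial_absorption boulet_sum_def sum_distrib_left
    by (intro sum.cong refl) (simp only: qpoch_0 mult_ac mult_1_right mult_1_left)
  finally show ?thesis
    by (simp add: algebra_simps)
qed

lemma boulet_sum_shift_mod:
  "z ^ n dvd boulet_sum 1 z n 0 y - (1 + y * z) * boulet_sum 1 z n 0 (y * z\<^sup>2)"
proof (cases n)
  case (Suc l)
  let ?D = "\<lambda>n. boulet_sum 1 z n 0 (y * z\<^sup>2)"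
  \<comment> \<open>Two errors arise: replacing the sum for l by that for l+1, and dropping q^(l+1)
    = z^(2(l+1)).\<close>
  have "boulet_sum 1 z n 0 y - (1 + y * z) * ?D n
    = - (y * z) * (?D (Suc l) - ?D l) - z ^ Suc l * (z ^ Suc l * (y * z * ?D l))"
    using boulet_sum_shift[of z l y] Suc
    by (simp add: algebra_simps power_mult_distrib power2_eq_square)
  also have "z ^ Suc l dvd \<dots>"
    by (intro dvd_diff dvd_mult boulet_sum_Suc_eq_mod dvd_triv_left)
  finally show ?thesis
    using Suc by simp
qed simp

lemma boulet_sum_iterate_mod:
  "z ^ n dvd boulet_sum 1 z n 0 y - qpoch (y * z) (z\<^sup>2) l * boulet_sum 1 z n 0 (y * (z\<^sup>2) ^ l)"
proof (induction l arbitrary: y)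
  case (Suc l)
  let ?D = "boulet_sum 1 z n 0"
  let ?y = "y * z\<^sup>2"
  have "?D y - qpoch (y * z) (z\<^sup>2) (Suc l) * ?D (y * (z\<^sup>2) ^ Suc l)
    = (?D y - (1 + y * z) * ?D ?y)
      + (1 + y * z) * (?D ?y - qpoch (?y * z) (z\<^sup>2) l * ?D (?y * (z\<^sup>2) ^ l))"
    by (simp add: qpoch_Suc' algebra_simps)
  also have "z ^ n dvd \<dots>"
    by (intro dvd_add dvd_mult Suc.IH boulet_sum_shift_mod)
  finally show ?case .
qed simp

lemma dvd_boulet_sum_diff_0: "y dvd boulet_sum e z n x y - boulet_sum e z n x 0"
proof -
  have "boulet_sum e z n x y - boulet_sum e z n x 0
    = (\<Sum>i\<le>n. qbinomial (z\<^sup>2) n i * qpoch x (z\<^sup>2) (n - i + e) * z ^ i * (qpoch y (z\<^sup>2) i - 1))"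
    unfolding boulet_sum_def sum_subtractf [symmetric]
    by (intro sum.cong) (simp_all add: algebra_simps)
  also have "y dvd \<dots>"
    by (intro dvd_sum dvd_mult dvd_qpoch_minus_1)
  finally show ?thesis .
qed

theorem boulet_sum_product_mod:
  "z ^ n dvd boulet_sum 1 z n x y
     - qpoch x (z\<^sup>2) (Suc n) * (qpoch (y * z) (z\<^sup>2) n * (\<Prod>t<n. 1 + z ^ Suc t))"
proof -
  let ?D = "boulet_sum 1 z n 0" and ?P = "qpoch x (z\<^sup>2) (Suc n)" and ?R = "qpoch (y * z) (z\<^sup>2) n"
  let ?y = "y * (z\<^sup>2) ^ n"
  \<comment> \<open>After n shifts the argument y q^n is divisible by z^n and may be set to
    0.\<close>
  have "z ^ n dvd ?y"
    by (simp add: power_mult_distrib power2_eq_square)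
  then have "z ^ n dvd ?D ?y - ?D 0"
    using dvd_boulet_sum_diff_0 by (rule dvd_trans)
  then have "z ^ n dvd (boulet_sum 1 z n x y - ?P * ?D y) + ?P * ((?D y - ?R * ?D ?y) + ?R * (?D ?y - ?D 0))"
    by (intro dvd_add dvd_mult boulet_sum_eq_mod boulet_sum_iterate_mod)
  moreover have "boulet_sum 1 z n x y - ?P * (?R * ?D 0)
    = (boulet_sum 1 z n x y - ?P * ?D y) + ?P * ((?D y - ?R * ?D ?y) + ?R * (?D ?y - ?D 0))"
    by (simp add: algebra_simps)
  ultimately show ?thesis
    unfolding boulet_sum_0_0 [of 1 z n, symmetric]
    by (simp only:)
qed

section \<open>Generating functions of lists and of partitions into distinct parts\<close>

definition list_gf :: "('b \<Rightarrow> 'a) \<Rightarrow> 'b list set \<Rightarrow> 'a::comm_ring_1" where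
  "list_gf f L = (\<Sum>\<pi>\<in>L. prod_list (map f \<pi>))"

lemma list_gf_Nil [simp]: "list_gf f {[]} = 1"
  by (simp add: list_gf_def)

lemma list_gf_Un_Cons:
  assumes "finite L" "finite L'" "\<And>\<pi>. \<pi> \<in> L \<Longrightarrow> p \<notin> set \<pi>"
  shows "list_gf f (L \<union> Cons p ` L') = list_gf f L + f p * list_gf f L'"
proof -
  have "list_gf f (L \<union> Cons p ` L') = list_gf f L + list_gf f (Cons p ` L')"
    unfolding list_gf_def using assms by (intro sum.union_disjoint) fastforce+
  also have "list_gf f (Cons p ` L') = f p * list_gf f L'"
    unfolding list_gf_def by (simp add: sum.reindex sum_distrib_left)
  finally show ?thesis .
qed

definition strict_lists :: "nat set \<Rightarrow> nat list set" where
  "strict_lists S = {\<pi>. sorted_wrt (>) \<pi> \<and> set \<pi> \<subseteq> S}"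

lemma strict_lists_empty [simp]: "strict_lists {} = {[]}"
  by (auto simp: strict_lists_def)

lemma strict_lists_insert_max:
  assumes "\<And>s. s \<in> S \<Longrightarrow> s < p"
  shows "strict_lists (insert p S) = strict_lists S \<union> Cons p ` strict_lists S"
proof (intro equalityI subsetI)
  fix \<pi> assume \<pi>: "\<pi> \<in> strict_lists (insert p S)"
  show "\<pi> \<in> strict_lists S \<union> Cons p ` strict_lists S"
  proof (cases \<pi>)
    case (Cons r \<rho>)
    have "\<rho> \<in> strict_lists S" "r \<in> insert p S" "r = p \<or> p \<notin> set \<rho>"
      using \<pi> assms unfolding Cons strict_lists_def by (fastforce)+
    then show ?thesis
      using \<pi> Cons by (auto simp: strict_lists_def)
  qed (auto simp: strict_lists_def)
qed (use assms in \<open>force simp: strict_lists_def\<close>)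

text \<open>Elements are added in increasing order, so a new one can only be the head; omitting or
  taking it gives the factor 1 + f p.\<close>

lemma finite_strict_lists_gf:
  "finite S \<Longrightarrow> finite (strict_lists S) \<and> list_gf f (strict_lists S) = (\<Prod>p\<in>S. 1 + f p)"
proof (induction S rule: finite_linorder_max_induct)
  case (insert p S)
  then have "p \<notin> S"
    by blast
  have "strict_lists (insert p S) = strict_lists S \<union> Cons p ` strict_lists S"
    using insert by (intro strict_lists_insert_max) auto
  moreover have "p \<notin> set \<pi>" if "\<pi> \<in> strict_lists S" for \<pi>
    using that \<open>p \<notin> S\<close> by (auto simp: strict_lists_def)
  ultimately show ?case
    using insert \<open>p \<notin> S\<close> by (auto simp: list_gf_Un_Cons algebra_simps)
qed simp

section \<open>Alternating partitions and their generating function\<close>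

text \<open>The condition \<open>r \<le> k * (p div k)\<close> encodes \<open>k\<close>-strictness.\<close>

fun alternating :: "nat \<Rightarrow> nat \<Rightarrow> nat \<Rightarrow> nat list \<Rightarrow> bool" where
  "alternating k a b [] \<longleftrightarrow> True"
| "alternating k a b (p # \<pi>) \<longleftrightarrow> 0 < p \<and> (p mod k = 0 \<or> p mod k = a) \<and>
     (\<forall>r\<in>set \<pi>. r < p \<and> (p mod k \<noteq> 0 \<longrightarrow> r \<le> k * (p div k))) \<and> alternating k b a \<pi>"

definition alts :: "nat \<Rightarrow> nat \<Rightarrow> nat \<Rightarrow> nat \<Rightarrow> nat list set" where
  "alts k a b u = {\<pi>. alternating k a b \<pi> \<and> (\<forall>p\<in>set \<pi>. p \<le> u)}"

lemma alts_0 [simp]: "alts k a b 0 = {[]}"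
proof -
  have "\<pi> = []" if "\<pi> \<in> alts k a b 0" for \<pi>
    using that by (cases \<pi>) (auto simp: alts_def)
  then show ?thesis
    by (auto simp: alts_def)
qed

text \<open>A head divisible by k only forces the later parts to be smaller, so these still range up
  to k u + (k - 1).\<close>

lemma alts_Suc:
  assumes "0 < k"
  shows "alts k a b (k * Suc u) =
    alts k a b (k * u + (k - 1)) \<union> Cons (k * Suc u) ` alts k b a (k * u + (k - 1))"
    (is "?L = ?R")
proof (intro equalityI subsetI)
  have less: "p \<le> k * u + (k - 1) \<longleftrightarrow> p < k * Suc u" for p
    using assms by auto
  fix \<pi> assume \<pi>: "\<pi> \<in> ?L"
  show "\<pi> \<in> ?R"
  proof (cases \<pi>)
    case (Cons r \<rho>)
    show ?thesis
    proof (cases "r = k * Suc u")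
      case True
      with \<pi> Cons have "\<rho> \<in> alts k b a (k * u + (k - 1))"
        unfolding alts_def less by auto
      with True Cons show ?thesis by blast
    next
      case False
      with \<pi> Cons have "r < k * Suc u" "\<forall>p\<in>set \<rho>. p < r"
        by (simp_all only: alts_def mem_Collect_eq list.set insert_iff alternating.simps) force+
      with \<pi> Cons have "\<pi> \<in> alts k a b (k * u + (k - 1))"
        unfolding alts_def less by (simp del: mult_Suc_right) (metis less_trans)
      then show ?thesis ..
    qed
  qed (auto simp: alts_def)
next
  have less: "p \<le> k * u + (k - 1) \<longleftrightarrow> p < k * Suc u" for p
    using assms by auto
  fix \<pi> assume "\<pi> \<in> ?R"
  then show "\<pi> \<in> ?L"
    unfolding alts_def less using assms by (auto simp del: mult_Suc_right intro: less_imp_le)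
qed

text \<open>The only admissible head above k u is k u + a. Its residue is non-zero, so strictness
  pushes all later parts down to at most k u.\<close>

lemma alts_block:
  assumes "0 < a" "a < k" "0 < b" "b < k"
  shows "alts k a b (k * u + (k - 1)) =
    alts k a b (k * u) \<union> Cons (k * u + a) ` alts k b a (k * u)"
    (is "?L = ?R")
proof (intro equalityI subsetI)
  have block: "p \<le> k * u \<or> p = k * u + c" if "p \<le> k * u + (k - 1)" "p mod k = 0 \<or> p mod k = c" for p c
  proof (cases "p \<le> k * u")
    case False
    then have "p div k = u"
      using that assms by (intro div_nat_eqI) auto
    then have "p = k * u + p mod k"
      by (metis mult_div_mod_eq)
    with that False show ?thesis by auto
  qed auto
  fix \<pi> assume \<pi>: "\<pi> \<in> ?L"
  show "\<pi> \<in> ?R"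
  proof (cases \<pi>)
    case (Cons r \<rho>)
    then have "r \<le> k * u \<or> r = k * u + a"
      using \<pi> by (intro block) (auto simp: alts_def)
    then show ?thesis
    proof
      assume "r = k * u + a"
      moreover from this have "r mod k = a" "r div k = u"
        using assms by auto
      ultimately have "\<rho> \<in> alts k b a (k * u)"
        using \<pi> Cons assms by (auto simp: alts_def)
      then show ?thesis
        using \<open>r = k * u + a\<close> Cons by blast
    next
      assume "r \<le> k * u"
      then have "\<pi> \<in> alts k a b (k * u)"
        using \<pi> Cons unfolding alts_def by fastforce
      then show ?thesis ..
    qed
  qed (auto simp: alts_def)
next
  fix \<pi> assume "\<pi> \<in> ?R"
  then show "\<pi> \<in> ?L"
    using assms by (fastforce simp: alts_def)
qed

lemma finite_alts: "finite (alts k a b u)"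
proof (rule finite_subset)
  have "sorted_wrt (>) \<pi>" if "alternating k a b \<pi>" for \<pi>
    using that by (induction k a b \<pi> rule: alternating.induct) auto
  then show "alts k a b u \<subseteq> strict_lists {..u}"
    by (auto simp: alts_def strict_lists_def)
  show "finite (strict_lists {..u})"
    using finite_strict_lists_gf by blast
qed

lemma alts_gf_block:
  assumes "0 < a" "a < k" "0 < b" "b < k"
    and "\<And>u. f (k * u) = z ^ u" "\<And>u. f (k * u + a) = x * z ^ u" "\<And>u. f (k * u + b) = y * z ^ u"
    and "list_gf f (alts k a b (k * n)) = boulet_sum 0 z n x y"
    and "list_gf f (alts k b a (k * n)) = boulet_sum 0 z n y x"
  shows "list_gf f (alts k a b (k * n + (k - 1))) = boulet_sum 1 z n x y"
proof -
  have "list_gf f (alts k a b (k * n + (k - 1)))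
    = list_gf f (alts k a b (k * n)) + f (k * n + a) * list_gf f (alts k b a (k * n))"
    unfolding alts_block[OF assms(1-4)]
    using \<open>0 < a\<close> by (intro list_gf_Un_Cons finite_alts) (auto simp: alts_def)
  then show ?thesis
    unfolding boulet_sum_odd assms(5-) .
qed

lemma alts_gf:
  assumes ab: "0 < a" "a < k" "0 < b" "b < k"
    and f: "\<And>u. f (k * u) = z ^ u" "\<And>u. f (k * u + a) = x * z ^ u" "\<And>u. f (k * u + b) = y * z ^ u"
  shows "list_gf f (alts k a b (k * n + (k - 1))) = boulet_sum 1 z n x y"
proof -
  \<comment> \<open>Tails have a and b exchanged, so both orders are treated at once.\<close>
  have "list_gf f (alts k a b (k * n)) = boulet_sum 0 z n x y \<and>
        list_gf f (alts k b a (k * n)) = boulet_sum 0 z n y x"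
  proof (induction n)
    case 0
    show ?case by (simp add: boulet_sum_def)
  next
    case (Suc n)
    have full: "list_gf f (alts k a b (k * n + (k - 1))) = boulet_sum 1 z n x y"
      "list_gf f (alts k b a (k * n + (k - 1))) = boulet_sum 1 z n y x"
      using Suc by (intro alts_gf_block ab f; blast)+
    have "list_gf f (alts k c d (k * Suc n)) = list_gf f (alts k c d (k * n + (k - 1)))
      + f (k * Suc n) * list_gf f (alts k d c (k * n + (k - 1)))" for c d
      unfolding alts_Suc[OF order.strict_trans[OF ab(1,2)]]
      using ab by (intro list_gf_Un_Cons finite_alts) (auto simp: alts_def)
    from this[of a b] this[of b a] show ?case
      unfolding full f boulet_sum_even by blast
  qed
  then show ?thesis
    using assms by (intro alts_gf_block) auto
qed

section \<open>Generating function of the partitions into distinct parts from the \<open>C\<close>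
  residue classes\<close>

text \<open>The classes of k and 2k modulo 2k merge into the multiples of k. The range lengths match
  the three products in \<open>boulet_sum_product_mod\<close>.\<close>

definition C_parts :: "nat \<Rightarrow> nat \<Rightarrow> nat \<Rightarrow> nat \<Rightarrow> nat set" where
  "C_parts k a b n = (\<lambda>t. k * Suc t) ` {..<n} \<union> (\<lambda>t. 2 * k * t + a) ` {..<Suc n} \<union>
     (\<lambda>t. 2 * k * t + (k + b)) ` {..<n}"

lemma finite_C_parts: "finite (C_parts k a b n)"
  by (simp add: C_parts_def)

lemma C_parts_gf:
  assumes ab: "0 < a" "a < k" "0 < b" "b < k" "a \<noteq> b"
    and f: "\<And>u. f (k * u) = z ^ u" "\<And>u. f (2 * k * u + a) = x * (z\<^sup>2) ^ u"
      "\<And>u. f (2 * k * u + (k + b)) = y * z * (z\<^sup>2) ^ u"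
  shows "list_gf f (strict_lists (C_parts k a b n)) =
    qpoch x (z\<^sup>2) (Suc n) * (qpoch (y * z) (z\<^sup>2) n * (\<Prod>t<n. 1 + z ^ Suc t))"
proof -
  let ?A = "(\<lambda>t. k * Suc t) ` {..<n}" and ?B = "(\<lambda>t. 2 * k * t + a) ` {..<Suc n}"
    and ?C = "(\<lambda>t. 2 * k * t + (k + b)) ` {..<n}"
  \<comment> \<open>The residues b, a and 0 modulo k already separate the three families.\<close>
  have "2 * k * t + (k + b) = b + k * (2 * t + 1)" "2 * k * t + a = a + k * (2 * t)" for t
    by (simp_all add: algebra_simps)
  then have mods: "(2 * k * t + (k + b)) mod k = b" "(2 * k * t + a) mod k = a" for t
    using ab by (simp_all only: mod_mult_self2 mod_less)
  have disj: "S \<inter> T = {}" if "\<forall>p\<in>S. p mod k = c" "\<forall>p\<in>T. p mod k = d" "c \<noteq> d" for S T c d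
    using that by (metis disjoint_iff)
  have A: "\<forall>p\<in>?A. p mod k = 0" and B: "\<forall>p\<in>?B. p mod k = a" and C: "\<forall>p\<in>?C. p mod k = b"
    using mods by auto
  have "?A \<inter> ?B = {}" "?A \<inter> ?C = {}" "?B \<inter> ?C = {}"
    using disj[OF A B] disj[OF A C] disj[OF B C] ab by blast+
  then have "?A \<inter> ?B = {}" "(?A \<union> ?B) \<inter> ?C = {}"
    by (simp_all only: Int_Un_distrib2 Un_empty_left)
  then have "(\<Prod>p\<in>C_parts k a b n. 1 + f p) = (\<Prod>p\<in>?A. 1 + f p) * (\<Prod>p\<in>?B. 1 + f p) * (\<Prod>p\<in>?C. 1 + f p)"
    unfolding C_parts_def by (simp only: prod.union_disjoint finite_UnI finite_imageI finite_lessThan)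
  also have "(\<Prod>p\<in>?A. 1 + f p) = (\<Prod>t<n. 1 + z ^ Suc t)"
    using ab by (subst prod.reindex) (simp_all only: o_def f, simp add: inj_on_def)
  also have "(\<Prod>p\<in>?B. 1 + f p) = qpoch x (z\<^sup>2) (Suc n)"
    unfolding qpoch_def using ab by (subst prod.reindex) (simp_all only: o_def f, simp add: inj_on_def)
  also have "(\<Prod>p\<in>?C. 1 + f p) = qpoch (y * z) (z\<^sup>2) n"
    unfolding qpoch_def using ab by (subst prod.reindex) (simp_all only: o_def f, simp add: inj_on_def)
  finally show ?thesis
    using finite_strict_lists_gf[OF finite_C_parts[of k a b n], of f] by (simp add: mult_ac)
qed

section \<open>Matching the list encodings with the sets of partitions\<close>

lemma alternating_iff:
  "alternating k a b \<pi> \<longleftrightarrow>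
     sorted_wrt (\<lambda>p r. r < p \<and> (p mod k \<noteq> 0 \<longrightarrow> r \<le> k * (p div k))) \<pi> \<and> (\<forall>x\<in>set \<pi>. 0 < x) \<and>
     (\<forall>t<length \<pi>. \<pi> ! t mod k = 0 \<or> \<pi> ! t mod k = (if even t then a else b))"
proof (induction k a b \<pi> rule: alternating.induct)
  case (2 k a b p \<pi>)
  \<comment> \<open>Positions in the tail shift by one; the flipped parity matches the exchange of a
    and b.\<close>
  have swap: "(if \<not> P then a else b) = (if P then b else a)" for P
    by simp
  have "(\<forall>t<length (p # \<pi>). (p # \<pi>) ! t mod k = 0 \<or> (p # \<pi>) ! t mod k = (if even t then a else b)) \<longleftrightarrow>
    (p mod k = 0 \<or> p mod k = a) \<and>
    (\<forall>t<length \<pi>. \<pi> ! t mod k = 0 \<or> \<pi> ! t mod k = (if even t then b else a))"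
    by (simp only: length_Cons All_less_Suc2 nth_Cons_0 nth_Cons_Suc even_zero even_Suc if_True swap)
  then show ?case
    unfolding alternating.simps 2 by auto
qed simp

text \<open>In a decreasing list the larger part p of a forbidden pair is no multiple of k, and the
  smaller one lies above \<open>k * (p div k)\<close>.\<close>

lemma k_strict_iff:
  assumes "0 < k"
  shows "sorted_wrt (\<ge>) \<pi> \<and> k_strict k \<pi> \<and> distinct \<pi> \<longleftrightarrow>
    sorted_wrt (\<lambda>p r. r < p \<and> (p mod k \<noteq> 0 \<longrightarrow> r \<le> k * (p div k))) \<pi>"
    (is "?L \<longleftrightarrow> ?R")
proof
  assume L: ?L
  show ?R
    unfolding sorted_wrt_iff_nth_less
  proof (intro allI impI conjI)
    fix s t assume st: "s < t" "t < length \<pi>"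
    let ?p = "\<pi> ! s" and ?r = "\<pi> ! t"
    have "?r \<le> ?p" "?p \<noteq> ?r"
      using L st by (auto simp: sorted_wrt_iff_nth_less nth_eq_iff_index_eq)
    then show "?r < ?p" by simp
    assume nz: "?p mod k \<noteq> 0"
    show "?r \<le> k * (?p div k)"
    proof (rule ccontr)
      assume "\<not> ?r \<le> k * (?p div k)"
      then have "\<exists>d>0. k * (?p div k) + d = ?r"
        by (intro less_imp_add_positive) simp
      then obtain d where "0 < d" "k * (?p div k) + d = ?r"
        by blast
      then have d: "?r = ?p div k * k + d" "1 \<le> d"
        by (simp_all add: mult.commute)
      have p: "?p = ?p div k * k + ?p mod k"
        by simp
      have "d \<le> ?p mod k"
        using d p \<open>?r \<le> ?p\<close> by linarith
      moreover have "?p mod k \<le> k - 1"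
        using mod_less_divisor[OF assms, of ?p] by linarith
      moreover have "appear_together (?p div k * k + d) (?p div k * k + ?p mod k) \<pi>"
        unfolding appear_together_def using d p st by (metis less_trans less_irrefl)
      ultimately show False
        using L d unfolding k_strict_def by blast
    qed
  qed
next
  assume R: ?R
  then have dec: "\<pi> ! t < \<pi> ! s" if "s < t" "t < length \<pi>" for s t
    using that by (simp add: sorted_wrt_iff_nth_less)
  have "k_strict k \<pi>"
    unfolding k_strict_def appear_together_def
  proof (intro allI impI notI)
    fix m' r1 r2
    assume r: "1 \<le> r1 \<and> r1 \<le> r2 \<and> r2 \<le> k - 1"
      and "\<exists>s<length \<pi>. \<exists>t<length \<pi>. s \<noteq> t \<and> \<pi> ! s = m' * k + r1 \<and> \<pi> ! t = m' * k + r2"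
    then obtain s t where st: "s < length \<pi>" "t < length \<pi>" "s \<noteq> t"
      "\<pi> ! s = m' * k + r1" "\<pi> ! t = m' * k + r2"
      by blast
    \<comment> \<open>As r1 \<le> r2, the entry at t is not the smaller one and comes first; its
      residue r2 is non-zero, which bounds the entry at s by k m'.\<close>
    have "t < s"
      using dec[of s t] st r by linarith
    moreover have "\<pi> ! t mod k = r2" "\<pi> ! t div k = m'"
      using st r assms by auto
    ultimately have "\<pi> ! s \<le> k * m'"
      using R st r unfolding sorted_wrt_iff_nth_less by (metis not_one_le_zero le_trans)
    then show False
      using st r by (simp add: mult.commute)
  qed
  moreover have "distinct \<pi>"
    unfolding distinct_conv_nth by (metis dec less_irrefl linorder_neqE_nat)
  moreover have "sorted_wrt (\<ge>) \<pi>"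
    using dec by (simp add: sorted_wrt_iff_nth_less less_imp_le)
  ultimately show ?L by blast
qed

lemma A_partitions_iff:
  assumes "3 \<le> k" "m \<in> {1, 2}"
  shows "\<pi> \<in> A_partitions k m n \<longleftrightarrow> alternating k (3 - m) m \<pi> \<and> sum_list \<pi> = n"
proof -
  have cong: "[x = k] (mod k) \<longleftrightarrow> x mod k = 0" "[x = 3 - m] (mod k) \<longleftrightarrow> x mod k = 3 - m"
    "[x = m] (mod k) \<longleftrightarrow> x mod k = m" for x
    using assms by (auto simp: cong_def)
  have shift: "(\<forall>t\<in>{1..l}. P t) \<longleftrightarrow> (\<forall>t<l. P (Suc t))" for l P
    by (metis atLeastAtMost_iff One_nat_def Suc_le_eq Suc_le_mono Suc_pred le_zero_eq zero_less_Suc le0 Suc_leI)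
  \<comment> \<open>Odd one-based indices are even zero-based ones.\<close>
  have parity: "(\<forall>t\<in>{1..length \<pi>}. odd t \<longrightarrow> [\<pi> ! (t - 1) = k] (mod k) \<or> [\<pi> ! (t - 1) = 3 - m] (mod k)) \<and>
     (\<forall>t\<in>{1..length \<pi>}. even t \<longrightarrow> [\<pi> ! (t - 1) = k] (mod k) \<or> [\<pi> ! (t - 1) = m] (mod k)) \<longleftrightarrow>
     (\<forall>t<length \<pi>. \<pi> ! t mod k = 0 \<or> \<pi> ! t mod k = (if even t then 3 - m else m))"
    unfolding cong shift by auto
  have "0 < k"
    using assms by simp
  show ?thesis
    unfolding A_partitions_def mem_Collect_eq partition_of_def alternating_iff
      parity k_strict_iff[OF \<open>0 < k\<close>, symmetric] by blast
qed

lemma C_parts_mod: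
  assumes "0 < a" "a < k" "0 < b" "b < k" "p \<in> C_parts k a b n"
  shows "0 < p \<and> p mod (2 * k) \<in> {a, k, k + b, 0}"
proof -
  have "(k * Suc t) mod (2 * k) \<in> {k, 0}" for t
  proof (cases "even t")
    case True
    then obtain u where "t = 2 * u" ..
    then have "k * Suc t = k + 2 * k * u" by simp
    then show ?thesis
      using assms by (simp del: mult_Suc_right)
  next
    case False
    then obtain u where "t = 2 * u + 1" ..
    then have "k * Suc t = 2 * k * (u + 1)" by simp
    then show ?thesis
      by (simp only: mod_mult_self1_is_0) simp
  qed
  moreover have "(2 * k * t + c) mod (2 * k) = c" if "c < 2 * k" for t c
    using that by (simp only: mod_mult_self4 mod_less)
  ultimately show ?thesis
    using assms unfolding C_parts_def by (auto simp del: mult_Suc_right)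
qed

lemma C_parts_memI:
  assumes "0 < k" "0 < p" "p \<le> n" "p mod (2 * k) \<in> {a, k, k + b, 0}"
  shows "p \<in> C_parts k a b n"
proof -
  let ?u = "p div (2 * k)"
  have p: "p = 2 * k * ?u + p mod (2 * k)"
    by simp
  have "?u \<le> k * ?u" "?u \<le> 2 * k * ?u"
    using \<open>0 < k\<close> by simp_all
  consider "p mod (2 * k) = a" | "p mod (2 * k) = k" | "p mod (2 * k) = k + b" | "p mod (2 * k) = 0"
    using assms(4) by auto
  then show ?thesis
  proof cases
    case 1
    then have "?u < Suc n"
      using p assms \<open>?u \<le> 2 * k * ?u\<close> by linarith
    moreover have "p = 2 * k * ?u + a"
      using p unfolding 1 .
    ultimately show ?thesis
      unfolding C_parts_def by (intro UnI1[OF UnI2] image_eqI[of _ _ ?u]) simp_all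
  next
    case 2
    have "2 * ?u < n"
      using p 2 assms \<open>?u \<le> k * ?u\<close> by linarith
    moreover have "p = k * Suc (2 * ?u)"
      using p 2 by simp
    ultimately show ?thesis
      unfolding C_parts_def by blast
  next
    case 3
    then have "?u < n"
      using p assms \<open>?u \<le> 2 * k * ?u\<close> by linarith
    moreover have "p = 2 * k * ?u + (k + b)"
      using p unfolding 3 .
    ultimately show ?thesis
      unfolding C_parts_def by (intro UnI2 image_eqI[of _ _ ?u]) simp_all
  next
    case 4
    \<comment> \<open>As p > 0, the quotient is not 0; the part 2k(l+1) is the multiple of k with
      index 2l+1.\<close>
    then obtain l where l: "?u = Suc l"
      using p assms by (cases ?u) auto
    have "p = k * Suc (2 * l + 1)"
      using p 4 l by simp
    moreover from this have "2 * l + 1 < n"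
      using assms by (metis Suc_le_lessD le_trans mult_le_mono1 nat_mult_1 Suc_leI One_nat_def)
    ultimately show ?thesis
      unfolding C_parts_def by blast
  qed
qed

lemma C_partitions_iff:
  assumes "3 \<le> k" "m \<in> {1, 2}" "n \<le> l"
  shows "\<pi> \<in> C_partitions k m n \<longleftrightarrow> \<pi> \<in> strict_lists (C_parts k (3 - m) m l) \<and> sum_list \<pi> = n"
proof -
  have bounds: "0 < 3 - m" "3 - m < k" "0 < m" "m < k" and "0 < k"
    using assms by auto
  have cong: "[x = 3 - m] (mod 2 * k) \<or> [x = k] (mod 2 * k) \<or> [x = k + m] (mod 2 * k) \<or>
      [x = 2 * k] (mod 2 * k) \<longleftrightarrow> x mod (2 * k) \<in> {3 - m, k, k + m, 0}" for x
    using bounds by (simp add: cong_def)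
  have "(\<forall>x\<in>set \<pi>. 0 < x) \<and> (\<forall>x\<in>set \<pi>. x mod (2 * k) \<in> {3 - m, k, k + m, 0}) \<longleftrightarrow>
      set \<pi> \<subseteq> C_parts k (3 - m) m l" if "sum_list \<pi> = n"
  proof -
    have "x \<le> l" if "x \<in> set \<pi>" for x
      using member_le_sum_list[OF that] \<open>sum_list \<pi> = n\<close> assms by simp
    then have "0 < x \<and> x mod (2 * k) \<in> {3 - m, k, k + m, 0} \<longleftrightarrow> x \<in> C_parts k (3 - m) m l"
      if "x \<in> set \<pi>" for x
      using C_parts_memI[OF \<open>0 < k\<close>, of x l] C_parts_mod[OF bounds, of x l] that by (intro iffI) simp_all
    then show ?thesis by blast
  qed
  \<comment> \<open>1-strictness is vacuous, so k = 1 leaves just strict decrease.\<close>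
  moreover have "sorted_wrt (\<ge>) \<pi> \<and> distinct \<pi> \<longleftrightarrow> sorted_wrt (>) \<pi>"
    using k_strict_iff[of 1 \<pi>] by (simp add: k_strict_def)
  ultimately show ?thesis
    unfolding C_partitions_def strict_lists_def partition_of_def mem_Collect_eq cong by blast
qed

section \<open>Polynomial weights and comparison of coefficients\<close>

text \<open>The outermost variable marks the size, so truncation by size becomes divisibility by a
  power of it.\<close>

definition mon :: "nat \<Rightarrow> nat \<Rightarrow> nat \<Rightarrow> int poly poly poly" where
  "mon i j n = monom (monom (monom 1 i) j) n"

lemma mon_mult: "mon i j n * mon i' j' n' = mon (i + i') (j + j') (n + n')"
  by (simp add: mon_def mult_monom)

lemma mon_0: "mon 0 0 0 = 1"
  by (simp add: mon_def monom_eq_1)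

lemma mon_power: "mon i j n ^ t = mon (i * t) (j * t) (n * t)"
  by (induction t) (simp_all add: mon_0 mon_mult)

definition part_weight :: "nat \<Rightarrow> nat \<Rightarrow> nat \<Rightarrow> nat \<Rightarrow> int poly poly poly" where
  "part_weight c d q p = mon (of_bool [p = c] (mod q)) (of_bool [p = d] (mod q)) p"

lemma prod_list_part_weight:
  "prod_list (map (part_weight c d q) \<pi>) = mon (parts_cong c q \<pi>) (parts_cong d q \<pi>) (sum_list \<pi>)"
  by (induction \<pi>) (simp_all add: part_weight_def parts_cong_def mon_0 mon_mult)

lemma coeff_list_gf_part_weight:
  assumes "finite L"
  shows "coeff (coeff (coeff (list_gf (part_weight c d q) L) n) j) i =
    int (card {\<pi> \<in> L. sum_list \<pi> = n \<and> parts_cong c q \<pi> = i \<and> parts_cong d q \<pi> = j})"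
proof -
  have "coeff (coeff (coeff (mon i' j' n') n) j) i = (if n' = n \<and> i' = i \<and> j' = j then 1 else 0)" for i' j' n'
    by (simp add: mon_def)
  then have "coeff (coeff (coeff (list_gf (part_weight c d q) L) n) j) i =
    (\<Sum>\<pi>\<in>L. if sum_list \<pi> = n \<and> parts_cong c q \<pi> = i \<and> parts_cong d q \<pi> = j then 1 else 0)"
    by (simp only: list_gf_def prod_list_part_weight coeff_sum)
  also have "\<dots> = int (card {\<pi> \<in> L. sum_list \<pi> = n \<and> parts_cong c q \<pi> = i \<and> parts_cong d q \<pi> = j})"
    using assms by (simp flip: sum.inter_filter)
  finally show ?thesis .
qed

lemma list_gf_alts_C_parts_mod:
  assumes "0 < a" "a < k" "0 < b" "b < k" "a \<noteq> b"
  shows "monom 1 (k * n) dvd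
    list_gf (part_weight a b k) (alts k a b (k * n + (k - 1))) -
    list_gf (part_weight a (k + b) (2 * k)) (strict_lists (C_parts k a b n))"
proof -
  \<comment> \<open>Here z is \<open>mon 0 0 k\<close>, x is \<open>mon 1 0 a\<close> and y is
    \<open>mon 0 1 b\<close>; the sizes a and b are absorbed into x and y.\<close>
  have 1: "part_weight a b k (k * u) = mon 0 0 k ^ u"
    "part_weight a b k (k * u + a) = mon 1 0 a * mon 0 0 k ^ u"
    "part_weight a b k (k * u + b) = mon 0 1 b * mon 0 0 k ^ u" for u
    using assms by (simp_all add: part_weight_def cong_def mon_power mon_mult add.commute)
  \<comment> \<open>Reduced modulo 2k, a multiple of k stays one, so it is never a or k + b and gets
    no mark.\<close>
  have "(k * u) mod (2 * k) mod k = 0" for u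
    by (simp add: mod_mod_cancel)
  then have m: "(k * u) mod (2 * k) \<noteq> a" "(k * u) mod (2 * k) \<noteq> k + b" for u
    using assms by (metis mod_less less_irrefl, metis mod_add_self1 mod_less less_irrefl)
  have r: "(2 * k * u + a) mod (2 * k) = a" "(2 * k * u + (k + b)) mod (2 * k) = k + b"
    "a mod (2 * k) = a" "(k + b) mod (2 * k) = k + b" for u
    using assms by (simp_all only: mod_mult_self4 mod_less)
  have 2: "part_weight a (k + b) (2 * k) (k * u) = mon 0 0 k ^ u"
    "part_weight a (k + b) (2 * k) (2 * k * u + a) = mon 1 0 a * ((mon 0 0 k)\<^sup>2) ^ u"
    "part_weight a (k + b) (2 * k) (2 * k * u + (k + b)) = mon 0 1 b * mon 0 0 k * ((mon 0 0 k)\<^sup>2) ^ u" for u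
    unfolding part_weight_def cong_def r using m assms
    by (simp_all add: mon_power mon_mult) (simp_all add: algebra_simps)
  have "monom 1 (k * n) = mon 0 0 k ^ n"
    by (simp add: mon_def monom_eq_1 monom_power)
  then show ?thesis
    using boulet_sum_product_mod[of "mon 0 0 k" n "mon 1 0 a" "mon 0 1 b"]
    by (simp only: alts_gf[OF assms(1-4) 1] C_parts_gf[OF assms 2])
qed

lemma card_eq_if_fibres_eq:
  assumes "finite S" "finite T"
    and "\<And>y. card {s \<in> S. f s = y} = card {t \<in> T. g t = y}"
  shows "card S = card T"
proof -
  let ?I = "f ` S \<union> g ` T"
  have "card S = (\<Sum>y\<in>?I. card {s \<in> S. f s = y})"
    using sum.group[of S ?I f "\<lambda>_. 1::nat"] assms by simp
  also have "\<dots> = (\<Sum>y\<in>?I. card {t \<in> T. g t = y})"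
    using assms by simp
  also have "\<dots> = card T"
    using sum.group[of T ?I g "\<lambda>_. 1::nat"] assms by simp
  finally show ?thesis .
qed

theorem theorem2p8:
  fixes n i j k m :: nat
  assumes "k \<ge> 3" and "m \<in> {1, 2}"
  shows "card {\<pi> \<in> A_partitions k m n.
             parts_cong (3 - m) k \<pi> = i \<and> parts_cong m k \<pi> = j}
         = card {\<pi> \<in> C_partitions k m n.
             parts_cong (3 - m) (2 * k) \<pi> = i \<and> parts_cong (k + m) (2 * k) \<pi> = j}
         \<and> A k m n = C k m n"
proof -
  have refined: "card {\<pi> \<in> A_partitions k m n. parts_cong (3 - m) k \<pi> = i \<and> parts_cong m k \<pi> = j} =
    card {\<pi> \<in> C_partitions k m n. parts_cong (3 - m) (2 * k) \<pi> = i \<and> parts_cong (k + m) (2 * k) \<pi> = j}"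
    for i j
  proof -
    \<comment> \<open>With n + 1 instead of n, the bound n < k l holds for n = 0 too, so the
      congruence modulo the power k l fixes the coefficient at n.\<close>
    let ?l = "Suc n"
    let ?A = "alts k (3 - m) m (k * ?l + (k - 1))" and ?C = "strict_lists (C_parts k (3 - m) m ?l)"
    have "1 * ?l \<le> k * ?l"
      using assms by (intro mult_le_mono1) simp
    then have "n < k * ?l"
      by (simp only: mult_1 Suc_le_eq)
    moreover have "monom 1 (k * ?l) dvd list_gf (part_weight (3 - m) m k) ?A -
        list_gf (part_weight (3 - m) (k + m) (2 * k)) ?C"
      using assms by (intro list_gf_alts_C_parts_mod) auto
    ultimately have "coeff (list_gf (part_weight (3 - m) m k) ?A) n =
        coeff (list_gf (part_weight (3 - m) (k + m) (2 * k)) ?C) n"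
      by (simp only: monom_1_dvd_iff' coeff_diff) simp
    then have "int (card {\<pi> \<in> ?A. sum_list \<pi> = n \<and> parts_cong (3 - m) k \<pi> = i \<and> parts_cong m k \<pi> = j}) =
      int (card {\<pi> \<in> ?C. sum_list \<pi> = n \<and> parts_cong (3 - m) (2 * k) \<pi> = i \<and> parts_cong (k + m) (2 * k) \<pi> = j})"
      by (simp only: coeff_list_gf_part_weight[OF finite_alts, symmetric]
        coeff_list_gf_part_weight[OF finite_strict_lists_gf[OF finite_C_parts, THEN conjunct1], symmetric])
    then have "card {\<pi> \<in> ?A. sum_list \<pi> = n \<and> parts_cong (3 - m) k \<pi> = i \<and> parts_cong m k \<pi> = j} =
      card {\<pi> \<in> ?C. sum_list \<pi> = n \<and> parts_cong (3 - m) (2 * k) \<pi> = i \<and> parts_cong (k + m) (2 * k) \<pi> = j}"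
      by (simp only: of_nat_eq_iff)
    moreover have "\<pi> \<in> A_partitions k m n \<longleftrightarrow> \<pi> \<in> ?A \<and> sum_list \<pi> = n" for \<pi>
    proof -
      have "p \<le> k * ?l + (k - 1)" if "p \<in> set \<pi>" "sum_list \<pi> = n" for p
        using member_le_sum_list[OF that(1)] that(2) \<open>n < k * ?l\<close> by linarith
      then show ?thesis
        unfolding A_partitions_iff[OF assms] alts_def by blast
    qed
    moreover have "\<pi> \<in> C_partitions k m n \<longleftrightarrow> \<pi> \<in> ?C \<and> sum_list \<pi> = n" for \<pi>
      using assms by (intro C_partitions_iff) auto
    ultimately show ?thesis
      by (simp only: conj_assoc)
  qed
  \<comment> \<open>The refined equality is summed over all pairs (i, j).\<close>
  have "A k m n = C k m n"
    unfolding A_def C_def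
    by (rule card_eq_if_fibres_eq[OF finite_A_partitions finite_C_partitions,
          where f = "\<lambda>\<pi>. (parts_cong (3 - m) k \<pi>, parts_cong m k \<pi>)"
            and g = "\<lambda>\<pi>. (parts_cong (3 - m) (2 * k) \<pi>, parts_cong (k + m) (2 * k) \<pi>)"])
      (use refined in auto)
  with refined show ?thesis by blast
qed

end
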